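(* There exists a randomized algorithm which, given cut-query oracle access to an unweighted, undirected simple graph $G=(V,E)$ on $n$ vertices and two distinct vertices $s,t\in V$, makes $\widetilde{O}(n^{5/3})$ queries and with high probability outputs an exact minimum $s$-$t$ cut of $G$.
   Context: A cut query takes a set $S\subseteq V$ and returns $c(S)$, the number of edges of $G$ with exactly one endpoint in $S$. A minimum $s$-$t$ cut is a set $S\subseteq V$ with $s\in S$, $t\notin S$ minimizing $c(S)$. $\widetilde{O}(x)$ denotes $O(x\cdot \mathrm{polylog}(x))$. "With high probability" means with probability at least $1-n^{-\Omega(1)}$. *)

theory Defs
  imports "HOL-Probability.Probability"
begin

definition simple_graph :: "nat \<Rightarrow> (nat \<Rightarrow> nat \<Rightarrow> bool) \<Rightarrow> bool" where
  "simple_graph n E \<longleftrightarrow>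
     (\<forall>u v. E u v \<longrightarrow> E v u) \<and> (\<forall>u. \<not> E u u) \<and> (\<forall>u v. E u v \<longrightarrow> u < n \<and> v < n)"

text \<open>c(S): number of edges with exactly one endpoint in S (each edge counted once,
  as the ordered pair (u,v) with u in S and v not in S).\<close>

definition cut_value :: "nat \<Rightarrow> (nat \<Rightarrow> nat \<Rightarrow> bool) \<Rightarrow> nat set \<Rightarrow> nat" where
  "cut_value n E S = card {(u, v). u \<in> S \<and> u < n \<and> v \<notin> S \<and> v < n \<and> E u v}"

definition min_st_cut :: "nat \<Rightarrow> (nat \<Rightarrow> nat \<Rightarrow> bool) \<Rightarrow> nat \<Rightarrow> nat \<Rightarrow> nat set \<Rightarrow> bool" where
  "min_st_cut n E s t S \<longleftrightarrow>
     S \<subseteq> {0..<n} \<and> s \<in> S \<and> t \<notin> S \<and>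
     (\<forall>S'. S' \<subseteq> {0..<n} \<and> s \<in> S' \<and> t \<notin> S' \<longrightarrow> cut_value n E S \<le> cut_value n E S')"

text \<open>Deterministic adaptive cut-query algorithms as decision trees:
  either output a set, or query a set S and continue depending on the answer c(S).\<close>

datatype qtree = Ret "nat set" | Query "nat set" "nat \<Rightarrow> qtree"

primrec run_output :: "nat \<Rightarrow> (nat \<Rightarrow> nat \<Rightarrow> bool) \<Rightarrow> qtree \<Rightarrow> nat set" where
  "run_output n E (Ret S) = S"
| "run_output n E (Query S f) = run_output n E (f (cut_value n E S))"

primrec run_queries :: "nat \<Rightarrow> (nat \<Rightarrow> nat \<Rightarrow> bool) \<Rightarrow> qtree \<Rightarrow> nat" where
  "run_queries n E (Ret S) = 0"
| "run_queries n E (Query S f) = Suc (run_queries n E (f (cut_value n E S)))"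

text \<open>A randomized algorithm is, for each input (n, s, t), a probability distribution
  over deterministic query algorithms (random coins drawn up front).\<close>

type_synonym rand_alg = "nat \<Rightarrow> nat \<Rightarrow> nat \<Rightarrow> qtree pmf"

end

theory Submission
  imports Defs
begin

text \<open>
  A deterministic algorithm suffices. A unit-capacity flow from \<open>s\<close> to \<open>t\<close> is augmented along
  residual paths; since the flow is known, three cut queries tell whether a residual arc leads from
  one vertex set to a disjoint one, and binary search then exhibits such an arc with \<open>O(log n)\<close>
  queries. (Three queries, because twice the number of edges between disjoint sets \<open>A\<close> and \<open>B\<close> is
  \<open>c(A) + c(B) - c(A \<union> B)\<close>.)

  While the distance label of \<open>s\<close> is below \<open>D = n\<^bsup>2/3\<^esup>\<close>, augmenting paths are found by depth-first
  search along arcs that decrease the label by one, and a vertex with no such outgoing arc is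
  relabelled. There are at most \<open>n D\<close> relabellings, and at most \<open>n\<close> augmenting paths, each of length
  at most \<open>D\<close>. Once \<open>s\<close> has label \<open>D\<close>, some two consecutive levels have at most \<open>2n/D\<close> vertices
  together, so the flow is within \<open>2(n/D)\<^sup>2 \<le> 2D\<close> of the minimum cut. Each of the remaining
  augmentations grows a tree of residual arcs from \<open>s\<close>, with \<open>O(n)\<close> arc searches.

  Knowledge gained by queries is modelled as a predicate on graphs: \<open>solvable q \<Phi>\<close> says that one query
  tree finds a minimum cut within \<open>q\<close> queries on every graph satisfying \<open>\<Phi>\<close>.
\<close>

section \<open>Residual arcs and unit flows along paths\<close>

text \<open>An edge has capacity 1 in both directions and carries net flow -1, 0 or 1. Only flow 1
  saturates it; opposing flow leaves residual capacity 2.\<close>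

definition residual :: "(nat \<Rightarrow> nat \<Rightarrow> int) \<Rightarrow> (nat \<Rightarrow> nat \<Rightarrow> bool) \<Rightarrow> nat \<Rightarrow> nat \<Rightarrow> bool" where
  "residual x E u v \<longleftrightarrow> E u v \<and> x u v \<noteq> 1"

definition feasible :: "(nat \<Rightarrow> nat \<Rightarrow> int) \<Rightarrow> (nat \<Rightarrow> nat \<Rightarrow> bool) \<Rightarrow> bool" where
  "feasible x E \<longleftrightarrow> (\<forall>u v. \<bar>x u v\<bar> \<le> of_bool (E u v))"

text \<open>Paths are lists in reverse order: the head is the endpoint, the last element the source.\<close>

fun path_flow :: "nat list \<Rightarrow> nat \<Rightarrow> nat \<Rightarrow> int" where
  "path_flow (v # u # ps) a b =
     of_bool (a = u \<and> b = v) - of_bool (a = v \<and> b = u) + path_flow (u # ps) a b"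
| "path_flow _ a b = 0"

lemma residual_capacity:
  assumes "feasible x E"
  shows "of_bool (E u v) - x u v \<ge> 0" "of_bool (E u v) - x u v \<le> 2"
    "of_bool (E u v) - x u v = 0 \<longleftrightarrow> \<not> residual x E u v"
proof -
  have "\<bar>x u v\<bar> \<le> of_bool (E u v)" using assms by (simp add: feasible_def)
  then show "of_bool (E u v) - x u v \<ge> 0" "of_bool (E u v) - x u v \<le> 2"
    "of_bool (E u v) - x u v = 0 \<longleftrightarrow> \<not> residual x E u v"
    by (auto simp: residual_def of_bool_def split: if_splits)
qed

lemma path_flow_antisym: "path_flow ps a b + path_flow ps b a = 0"
proof (induction ps rule: induct_list012)
  case (3 v u ps)
  have "(of_bool (a = u \<and> b = v) :: int) = of_bool (b = v \<and> a = u)"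
    "(of_bool (a = v \<and> b = u) :: int) = of_bool (b = u \<and> a = v)"
    by (simp_all only: conj_commute)
  then show ?case using 3(2) unfolding path_flow.simps by linarith
qed auto

lemma path_flow_support: "path_flow ps a b \<noteq> 0 \<Longrightarrow> a \<in> set ps \<and> b \<in> set ps"
proof (induction ps rule: induct_list012)
  case (3 v u ps)
  then show ?case by (cases "path_flow (u # ps) a b = 0") (auto simp: of_bool_def split: if_splits)
qed auto

text \<open>A simple path joins two vertices by at most one arc: if the tail of the list contributes
  at \<open>a\<close>, \<open>b\<close>, both lie in that tail, so neither is the new head
  \<open>v\<close>.\<close>

lemma path_flow_cases:
  assumes "distinct ps" "successively (\<lambda>v u. R u v) ps"
  shows "path_flow ps a b = 0 \<or> path_flow ps a b = 1 \<and> R a b \<or> path_flow ps a b = -1 \<and> R b a"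
  using assms
proof (induction ps a b rule: path_flow.induct)
  case (1 v u ps a b)
  show ?case
  proof (cases "path_flow (u # ps) a b = 0")
    case True
    then show ?thesis using 1 by (auto simp: of_bool_def)
  next
    case False
    then have "a \<noteq> v" "b \<noteq> v" using path_flow_support[OF False] 1 by auto
    then show ?thesis using 1 by auto
  qed
qed auto

text \<open>An arc from \<open>u\<close> to \<open>v\<close> contributes
  \<open>of_bool (u \<in> S) - of_bool (v \<in> S)\<close>, and these terms telescope along the
  path.\<close>

lemma path_flow_crossing:
  assumes "set ps \<subseteq> V" "finite V" "S \<subseteq> V" "ps \<noteq> []"
  shows "(\<Sum>a\<in>S. \<Sum>b\<in>V - S. path_flow ps a b) = of_bool (last ps \<in> S) - of_bool (hd ps \<in> S)"
  using assms(1,4)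
proof (induction ps rule: induct_list012)
  case (3 v u ps)
  have fin: "finite S" using assms finite_subset by blast
  have pair: "(\<Sum>a\<in>S. \<Sum>b\<in>V - S. (of_bool (a = p \<and> b = q) :: int)) = of_bool (p \<in> S \<and> q \<in> V - S)"
    for p q
  proof -
    have "(\<Sum>a\<in>S. \<Sum>b\<in>V - S. (of_bool (a = p \<and> b = q) :: int))
        = (\<Sum>a\<in>S. \<Sum>b\<in>V - S. if b = q then of_bool (a = p) else 0)"
      by (intro sum.cong) auto
    also have "\<dots> = (\<Sum>a\<in>S. if a = p then of_bool (q \<in> V - S) else 0)"
      using assms(2) by (intro sum.cong) auto
    finally show ?thesis using fin by simp
  qed
  have "(\<Sum>a\<in>S. \<Sum>b\<in>V - S. path_flow (v # u # ps) a b)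
     = of_bool (u \<in> S \<and> v \<in> V - S) - of_bool (v \<in> S \<and> u \<in> V - S)
       + (\<Sum>a\<in>S. \<Sum>b\<in>V - S. path_flow (u # ps) a b)"
    by (simp add: sum.distrib sum_subtractf pair del: Diff_iff)
  then show ?case using 3 by (auto simp: of_bool_def)
qed auto

text \<open>Labels grow strictly along the reversed list. This makes a search path simple and bounds
  its length by the label of its source.\<close>

lemma label_path:
  assumes "successively (\<lambda>v u. d u = Suc (d v)) ps" "ps \<noteq> []"
  shows "distinct ps" "\<forall>v\<in>set ps. d (hd ps) \<le> d v" "Suc (d (last ps)) = d (hd ps) + length ps"
proof -
  have "distinct ps \<and> (\<forall>v\<in>set ps. d (hd ps) \<le> d v) \<and> Suc (d (last ps)) = d (hd ps) + length ps"
    using assms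
  proof (induction ps rule: induct_list012)
    case (3 v u ps)
    then have IH: "distinct (u # ps)" "\<forall>w\<in>set (u # ps). d u \<le> d w"
      "Suc (d (last (u # ps))) = d u + length (u # ps)" and uv: "d u = Suc (d v)" by auto
    have "v \<notin> set (u # ps)" using IH(2) uv by fastforce
    moreover have "\<forall>w\<in>set (u # ps). d v \<le> d w" using IH(2) uv by fastforce
    ultimately show ?case using IH uv by auto
  qed auto
  then show "distinct ps" "\<forall>v\<in>set ps. d (hd ps) \<le> d v"
    "Suc (d (last ps)) = d (hd ps) + length ps" by auto
qed

section \<open>Detecting residual arcs by cut queries\<close>

lemma cut_value_sum:
  assumes "S \<subseteq> {0..<n}"
  shows "int (cut_value n E S) = (\<Sum>u\<in>S. \<Sum>v\<in>{0..<n} - S. of_bool (E u v))"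
proof -
  have fin: "finite S" using assms finite_subset by blast
  have "{(u, v). u \<in> S \<and> u < n \<and> v \<notin> S \<and> v < n \<and> E u v}
      = {p \<in> S \<times> ({0..<n} - S). E (fst p) (snd p)}"
    using assms by auto
  then have "int (cut_value n E S) = int (card {p \<in> S \<times> ({0..<n} - S). E (fst p) (snd p)})"
    by (simp add: cut_value_def)
  also have "\<dots> = (\<Sum>p\<in>S \<times> ({0..<n} - S). of_bool (E (fst p) (snd p)))"
    using fin by (simp add: Int_def)
  also have "\<dots> = (\<Sum>u\<in>S. \<Sum>v\<in>{0..<n} - S. of_bool (E u v))"
    by (simp only: sum.cartesian_product split_def)
  finally show ?thesis .
qed

text \<open>Edges leaving the union cancel, while an edge between \<open>A\<close> and
  \<open>B\<close> is counted from both sides.\<close>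

lemma twice_edges_between:
  assumes "simple_graph n E" "A \<subseteq> {0..<n}" "B \<subseteq> {0..<n}" "A \<inter> B = {}"
  shows "2 * (\<Sum>u\<in>A. \<Sum>v\<in>B. (of_bool (E u v) :: int))
    = int (cut_value n E A) + int (cut_value n E B) - int (cut_value n E (A \<union> B))"
proof -
  define R where "R = {0..<n} - (A \<union> B)"
  define e :: "nat set \<Rightarrow> nat set \<Rightarrow> int" where "e X Y = (\<Sum>u\<in>X. \<Sum>v\<in>Y. of_bool (E u v))" for X Y
  have fin: "finite A" "finite B" "finite R"
    using assms finite_subset[OF _ finite_atLeastLessThan] unfolding R_def by blast+
  have "{0..<n} - A = B \<union> R" "{0..<n} - B = A \<union> R" using assms by (auto simp: R_def)
  moreover have "B \<inter> R = {}" "A \<inter> R = {}" by (auto simp: R_def)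
  ultimately have "int (cut_value n E A) = e A B + e A R" "int (cut_value n E B) = e B A + e B R"
    using assms fin by (simp_all add: cut_value_sum e_def sum.union_disjoint sum.distrib
        del: sum_of_bool_eq)
  moreover have "int (cut_value n E (A \<union> B)) = e A R + e B R"
    using assms fin by (simp add: cut_value_sum e_def sum.union_disjoint flip: R_def
        del: sum_of_bool_eq)
  moreover have "e B A = e A B"
  proof -
    have "E u v = E v u" for u v using assms by (auto simp: simple_graph_def)
    then show ?thesis unfolding e_def by (subst sum.swap) simp
  qed
  ultimately show ?thesis by (simp add: e_def)
qed

text \<open>Residual capacities are nonnegative, so some arc exists exactly if their sum is nonzero;
  three answers and the known flow \<open>x\<close> determine twice that sum.\<close>

lemma exists_residual_iff:
  assumes "simple_graph n E" "feasible x E" "A \<subseteq> {0..<n}" "B \<subseteq> {0..<n}" "A \<inter> B = {}"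
  shows "(\<exists>u\<in>A. \<exists>v\<in>B. residual x E u v) \<longleftrightarrow>
    int (cut_value n E A) + int (cut_value n E B) - int (cut_value n E (A \<union> B))
      \<noteq> 2 * (\<Sum>u\<in>A. \<Sum>v\<in>B. x u v)"
proof -
  have fin: "finite A" "finite B" using assms finite_subset[OF _ finite_atLeastLessThan] by blast+
  have "(\<Sum>u\<in>A. \<Sum>v\<in>B. of_bool (E u v) - x u v) = 0 \<longleftrightarrow>
      (\<forall>u\<in>A. \<forall>v\<in>B. of_bool (E u v) - x u v = 0)"
    using fin residual_capacity(1)[OF assms(2)] by (simp add: sum_nonneg_eq_0_iff sum_nonneg)
  also have "\<dots> \<longleftrightarrow> \<not> (\<exists>u\<in>A. \<exists>v\<in>B. residual x E u v)"
    using residual_capacity(3)[OF assms(2)] by blast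
  finally show ?thesis
    using twice_edges_between[OF assms(1,3,4,5)] by (auto simp: sum_subtractf)
qed

section \<open>Query trees under partial knowledge of the graph\<close>

locale st_cut =
  fixes n s t :: nat
  assumes s_less: "s < n" and t_less: "t < n" and s_neq_t: "s \<noteq> t"
begin

definition separates :: "nat set \<Rightarrow> bool" where
  "separates S \<longleftrightarrow> S \<subseteq> {0..<n} \<and> s \<in> S \<and> t \<notin> S"

definition solvable :: "nat \<Rightarrow> ((nat \<Rightarrow> nat \<Rightarrow> bool) \<Rightarrow> bool) \<Rightarrow> bool" where
  "solvable q \<Phi> \<longleftrightarrow> (\<exists>T. \<forall>E. simple_graph n E \<and> \<Phi> E \<longrightarrow>
     run_queries n E T \<le> q \<and> min_st_cut n E s t (run_output n E T))"

text \<open>Flow conservation is replaced by the requirement that every cut carries the same net flow.\<close>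

definition is_flow :: "(nat \<Rightarrow> nat \<Rightarrow> int) \<Rightarrow> nat \<Rightarrow> (nat \<Rightarrow> nat \<Rightarrow> bool) \<Rightarrow> bool" where
  "is_flow x k E \<longleftrightarrow> simple_graph n E \<and> feasible x E \<and> (\<forall>u v. x u v + x v u = 0) \<and>
     (\<forall>S. separates S \<longrightarrow> (\<Sum>u\<in>S. \<Sum>v\<in>{0..<n} - S. x u v) = int k)"

lemma solvable_mono:
  assumes "solvable q \<Phi>" "q \<le> q'" "\<And>E. simple_graph n E \<Longrightarrow> \<Psi> E \<Longrightarrow> \<Phi> E"
  shows "solvable q' \<Psi>"
proof -
  obtain T where "\<And>E. simple_graph n E \<Longrightarrow> \<Phi> E \<Longrightarrow>
      run_queries n E T \<le> q \<and> min_st_cut n E s t (run_output n E T)"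
    using assms(1) unfolding solvable_def by blast
  then show ?thesis
    using assms(2,3) unfolding solvable_def by (intro exI[of _ T]) fastforce
qed

text \<open>Knowledge that fits no graph is trivially solvable, so a fitting graph may be fixed. It
  yields facts about the known data, such as bounds on the flow value, without entering the query
  tree.\<close>

lemma solvable_assume:
  assumes "\<And>E. simple_graph n E \<Longrightarrow> \<Phi> E \<Longrightarrow> solvable q \<Phi>"
  shows "solvable q \<Phi>"
  using assms unfolding solvable_def by blast

lemma solvable_test:
  assumes "A \<subseteq> {0..<n}" "B \<subseteq> {0..<n}" "A \<inter> B = {}"
    and feas: "\<And>E. \<Phi> E \<Longrightarrow> feasible x E"
    and "solvable q (\<lambda>E. \<Phi> E \<and> (\<exists>u\<in>A. \<exists>v\<in>B. residual x E u v))"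
    and "solvable q (\<lambda>E. \<Phi> E \<and> \<not> (\<exists>u\<in>A. \<exists>v\<in>B. residual x E u v))"
  shows "solvable (q + 3) \<Phi>"
proof -
  obtain T1 where T1: "\<And>E. simple_graph n E \<Longrightarrow> \<Phi> E \<Longrightarrow> \<exists>u\<in>A. \<exists>v\<in>B. residual x E u v \<Longrightarrow>
     run_queries n E T1 \<le> q \<and> min_st_cut n E s t (run_output n E T1)"
    using assms(5) unfolding solvable_def by blast
  obtain T2 where T2: "\<And>E. simple_graph n E \<Longrightarrow> \<Phi> E \<Longrightarrow> \<not> (\<exists>u\<in>A. \<exists>v\<in>B. residual x E u v) \<Longrightarrow>
     run_queries n E T2 \<le> q \<and> min_st_cut n E s t (run_output n E T2)"
    using assms(6) unfolding solvable_def by blast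
  define T where "T = Query A (\<lambda>a. Query B (\<lambda>b. Query (A \<union> B) (\<lambda>c.
    if int a + int b - int c \<noteq> 2 * (\<Sum>u\<in>A. \<Sum>v\<in>B. x u v) then T1 else T2)))"
  have "run_queries n E T \<le> q + 3 \<and> min_st_cut n E s t (run_output n E T)"
    if E: "simple_graph n E" "\<Phi> E" for E
  proof -
    note iff = exists_residual_iff[OF E(1) feas[OF E(2)] assms(1-3)]
    show ?thesis
    proof (cases "\<exists>u\<in>A. \<exists>v\<in>B. residual x E u v")
      case True
      then show ?thesis using T1[OF E True] iff by (simp add: T_def)
    next
      case False
      then show ?thesis using T2[OF E False] iff by (simp add: T_def)
    qed
  qed
  then show ?thesis unfolding solvable_def by blast
qed

text \<open>The third assumption abstracts the test for a witness in \<open>Y\<close>, so one search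
  serves both tails and heads of arcs. It covers knowledge \<open>\<Psi>\<close> stronger than
  \<open>\<Phi>\<close> because the test is made when a witness in \<open>X\<close> is already known
  to exist.\<close>

lemma solvable_binary_search:
  assumes "finite X" "card X \<le> 2 ^ j"
    and "\<And>\<Psi> Y r. Y \<subseteq> X \<Longrightarrow> (\<And>E. \<Psi> E \<Longrightarrow> \<Phi> E) \<Longrightarrow> solvable r (\<lambda>E. \<Psi> E \<and> (\<exists>y\<in>Y. P E y)) \<Longrightarrow>
       solvable r (\<lambda>E. \<Psi> E \<and> \<not> (\<exists>y\<in>Y. P E y)) \<Longrightarrow> solvable (r + 3) \<Psi>"
    and "\<And>y. y \<in> X \<Longrightarrow> solvable q (\<lambda>E. \<Phi> E \<and> P E y)"
  shows "solvable (q + 3 * j) (\<lambda>E. \<Phi> E \<and> (\<exists>y\<in>X. P E y))"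
  using assms
proof (induction j arbitrary: X)
  case 0
  show ?case
  proof (cases "X = {}")
    case True
    \<comment> \<open>No graph has a witness in the empty set, so any tree will do.\<close>
    then show ?thesis by (auto simp: solvable_def)
  next
    case False
    then have "card X = 1" using 0(1,2) by (simp add: Suc_leI card_gt_0_iff le_antisym)
    then obtain y where "X = {y}" using card_1_singletonE by blast
    then show ?thesis using 0(4)[of y] by simp
  qed
next
  case (Suc j)
  obtain Y where Y: "Y \<subseteq> X" "card Y = card X div 2"
    by (meson obtain_subset_with_card_n div_le_dividend)
  have cY: "card Y \<le> 2 ^ j" using Suc.prems(2) Y(2) by simp
  have fY: "finite Y" using Y(1) Suc.prems(1) finite_subset by blast
  have "card (X - Y) = card X - card X div 2"
    using Y fY by (simp add: card_Diff_subset)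
  then have cZ: "card (X - Y) \<le> 2 ^ j" using Suc.prems(2) by simp
  have "solvable (q + 3 * j) (\<lambda>E. \<Phi> E \<and> (\<exists>y\<in>Y. P E y))"
    by (rule Suc.IH[OF fY cY]) (use Y Suc.prems(3,4) in \<open>blast+\<close>)
  moreover have "solvable (q + 3 * j) (\<lambda>E. \<Phi> E \<and> (\<exists>y\<in>X - Y. P E y))"
    by (rule Suc.IH[OF _ cZ]) (use Suc.prems(1,3,4) in \<open>blast+\<close>)
  \<comment> \<open>A failed test on \<open>Y\<close> places the witness in \<open>X - Y\<close>
    without another query.\<close>
  ultimately have "solvable (q + 3 * j + 3) (\<lambda>E. \<Phi> E \<and> (\<exists>y\<in>X. P E y))"
    by (intro Suc.prems(3)[OF Y(1)]) (blast intro: solvable_mono[OF _ order_refl])+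
  then show ?case by (simp add: algebra_simps)
qed

text \<open>One test decides whether any arc exists; two searches of \<open>3 * j\<close> queries
  each then fix its tail and, for that tail, its head.\<close>

lemma solvable_find:
  assumes "A \<subseteq> {0..<n}" "B \<subseteq> {0..<n}" "A \<inter> B = {}" "n \<le> 2 ^ j"
    and feas: "\<And>E. \<Phi> E \<Longrightarrow> feasible x E"
    and found: "\<And>u v. u \<in> A \<Longrightarrow> v \<in> B \<Longrightarrow> solvable q (\<lambda>E. \<Phi> E \<and> residual x E u v)"
    and none: "solvable q (\<lambda>E. \<Phi> E \<and> \<not> (\<exists>u\<in>A. \<exists>v\<in>B. residual x E u v))"
  shows "solvable (q + (6 * j + 3)) \<Phi>"
proof -
  have fin: "finite A" "finite B" using assms finite_subset[OF _ finite_atLeastLessThan] by blast+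
  have card: "card A \<le> 2 ^ j" "card B \<le> 2 ^ j"
    using assms(4) card_mono[OF _ assms(1)] card_mono[OF _ assms(2)] by auto
  have "solvable (q + 3 * j) (\<lambda>E. \<Phi> E \<and> (\<exists>v\<in>B. residual x E u v))" if u: "u \<in> A" for u
  proof (rule solvable_binary_search[OF fin(2) card(2)])
    fix \<Psi> Y r
    assume Y: "Y \<subseteq> B" "\<And>E. \<Psi> E \<Longrightarrow> \<Phi> E" and
      "solvable r (\<lambda>E. \<Psi> E \<and> (\<exists>v\<in>Y. residual x E u v))"
      "solvable r (\<lambda>E. \<Psi> E \<and> \<not> (\<exists>v\<in>Y. residual x E u v))"
    then show "solvable (r + 3) \<Psi>"
      using u assms(1-3) by (intro solvable_test[of "{u}" Y \<Psi> x]) (auto intro: feas)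
  qed (use u found in blast)
  then have "solvable (q + 3 * j + 3 * j) (\<lambda>E. \<Phi> E \<and> (\<exists>u\<in>A. \<exists>v\<in>B. residual x E u v))"
  proof (intro solvable_binary_search[OF fin(1) card(1)])
    fix \<Psi> Y r
    assume Y: "Y \<subseteq> A" "\<And>E. \<Psi> E \<Longrightarrow> \<Phi> E" and
      "solvable r (\<lambda>E. \<Psi> E \<and> (\<exists>u\<in>Y. \<exists>v\<in>B. residual x E u v))"
      "solvable r (\<lambda>E. \<Psi> E \<and> \<not> (\<exists>u\<in>Y. \<exists>v\<in>B. residual x E u v))"
    then show "solvable (r + 3) \<Psi>"
      using assms(1-3) by (intro solvable_test[of Y B \<Psi> x]) (auto intro: feas)
  qed
  moreover have "solvable (q + 3 * j + 3 * j) (\<lambda>E. \<Phi> E \<and> \<not> (\<exists>u\<in>A. \<exists>v\<in>B. residual x E u v))"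
    using none by (rule solvable_mono) auto
  ultimately have "solvable (q + 3 * j + 3 * j + 3) \<Phi>"
    using assms(1-3) feas by (intro solvable_test[of A B \<Phi> x]) auto
  then show ?thesis by (rule solvable_mono) auto
qed

section \<open>Flows against cuts\<close>

text \<open>Source of weak duality, of optimality when no residual arc leaves \<open>S\<close>, and
  of the bound on the gap between the phases.\<close>

lemma cut_value_eq_flow_plus_residual:
  assumes "is_flow x k E" "separates S"
  shows "int (cut_value n E S) = int k + (\<Sum>u\<in>S. \<Sum>v\<in>{0..<n} - S. of_bool (E u v) - x u v)"
proof -
  have "S \<subseteq> {0..<n}" "(\<Sum>u\<in>S. \<Sum>v\<in>{0..<n} - S. x u v) = int k"
    using assms by (auto simp: is_flow_def separates_def)
  then show ?thesis by (simp add: cut_value_sum sum_subtractf)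
qed

lemma flow_le_cut_value:
  assumes "is_flow x k E" "separates S"
  shows "k \<le> cut_value n E S"
proof -
  have "(\<Sum>u\<in>S. \<Sum>v\<in>{0..<n} - S. of_bool (E u v) - x u v) \<ge> 0"
    using assms by (intro sum_nonneg residual_capacity(1)) (auto simp: is_flow_def)
  then show ?thesis using cut_value_eq_flow_plus_residual[OF assms] by linarith
qed

lemma flow_le:
  assumes "is_flow x k E"
  shows "k \<le> n"
proof -
  have "separates {s}" using s_less s_neq_t by (auto simp: separates_def)
  then have "int k = (\<Sum>v\<in>{0..<n} - {s}. x s v)" using assms by (auto simp: is_flow_def)
  also have "\<dots> \<le> (\<Sum>v\<in>{0..<n} - {s}. 1)"
  proof (rule sum_mono)
    fix v
    have "\<bar>x s v\<bar> \<le> of_bool (E s v)" using assms by (auto simp: is_flow_def feasible_def)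
    then show "x s v \<le> 1" by (auto simp: of_bool_def split: if_splits)
  qed
  also have "\<dots> \<le> int n" using s_less by simp
  finally show ?thesis by simp
qed

text \<open>A residual arc has room for one more unit, antisymmetry handles its reverse, and a path
  from \<open>s\<close> to \<open>t\<close> crosses every separating cut exactly once in
  net.\<close>

lemma is_flow_augment:
  assumes flow: "is_flow x k E" and ps: "distinct ps" "ps \<noteq> []" "hd ps = t" "last ps = s"
    and res: "successively (\<lambda>v u. residual x E u v) ps"
  shows "is_flow (\<lambda>a b. x a b + path_flow ps a b) (Suc k) E"
proof -
  have graph: "simple_graph n E" using flow by (simp add: is_flow_def)
  have anti: "x u v + x v u = 0" for u v using flow by (auto simp: is_flow_def)
  have bound: "\<bar>x u v\<bar> \<le> of_bool (E u v)" for u v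
    using flow by (auto simp: is_flow_def feasible_def)
  have "\<bar>x a b + path_flow ps a b\<bar> \<le> of_bool (E a b)" for a b
    using path_flow_cases[OF ps(1) res, of a b] bound[of a b] anti[of a b] graph
    by (auto simp: residual_def simple_graph_def of_bool_def split: if_splits)
  moreover have "(x u v + path_flow ps u v) + (x v u + path_flow ps v u) = 0" for u v
    using anti[of u v] path_flow_antisym[of ps u v] by simp
  moreover have "(\<Sum>u\<in>S. \<Sum>v\<in>{0..<n} - S. x u v + path_flow ps u v) = int (Suc k)"
    if S: "separates S" for S
  proof -
    have arc: "u < n" if "residual x E u v" for u v
      using that graph by (auto simp: residual_def simple_graph_def)
    \<comment> \<open>Every vertex after the head is the tail of a residual arc, hence of an
      edge.\<close>
    have "set ps \<subseteq> {0..<n}" if "hd ps < n" using ps(2) res that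
      by (induction ps rule: induct_list012) (auto dest: arc)
    then have "(\<Sum>u\<in>S. \<Sum>v\<in>{0..<n} - S. path_flow ps u v) = 1"
      using S ps t_less by (subst path_flow_crossing) (auto simp: separates_def)
    then show ?thesis using flow S by (simp add: sum.distrib is_flow_def)
  qed
  ultimately show ?thesis using graph by (simp add: is_flow_def feasible_def)
qed

lemma residual_closed_is_min_cut:
  assumes "is_flow x k E" "separates S" "\<not> (\<exists>u\<in>S. \<exists>v\<in>{0..<n} - S. residual x E u v)"
  shows "min_st_cut n E s t S"
proof -
  have "feasible x E" using assms by (simp add: is_flow_def)
  then have "(\<Sum>u\<in>S. \<Sum>v\<in>{0..<n} - S. of_bool (E u v) - x u v) = 0"
    using assms(3) residual_capacity(3) by (intro sum.neutral ballI) blast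
  then have "cut_value n E S = k" using cut_value_eq_flow_plus_residual[OF assms(1,2)] by simp
  then show ?thesis
    using assms(2) flow_le_cut_value[OF assms(1)] by (auto simp: min_st_cut_def separates_def)
qed

section \<open>Second phase: augmenting by residual trees\<close>

text \<open>\<open>W\<close> is the set reached from \<open>s\<close>, with \<open>p w\<close> a
  residual path to \<open>w\<close> inside \<open>W\<close>. A cut of value at most \<open>M\<close>
  is only known to exist; it limits the remaining augmentations.\<close>

definition tree_state ::
  "nat \<Rightarrow> (nat \<Rightarrow> nat \<Rightarrow> int) \<Rightarrow> nat \<Rightarrow> nat set \<Rightarrow> (nat \<Rightarrow> nat list) \<Rightarrow> (nat \<Rightarrow> nat \<Rightarrow> bool) \<Rightarrow> bool" where
  "tree_state M x k W p E \<longleftrightarrow> is_flow x k E \<and> (\<exists>S. separates S \<and> cut_value n E S \<le> M) \<and>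
     separates W \<and> (\<forall>w\<in>W. p w \<noteq> [] \<and> distinct (p w) \<and> set (p w) \<subseteq> W \<and> hd (p w) = w \<and>
       last (p w) = s \<and> successively (\<lambda>v u. residual x E u v) (p w))"

lemma tree_state_init:
  assumes "is_flow x k E" "separates S" "cut_value n E S \<le> M"
  shows "tree_state M x k {s} (\<lambda>_. [s]) E"
  using assms s_less s_neq_t by (auto simp: tree_state_def separates_def)

text \<open>Each arc search either enlarges \<open>W\<close>, reaches \<open>t\<close>, or proves
  \<open>W\<close> a minimum cut. Reaching \<open>t\<close> lowers \<open>M - k\<close>, whose
  weight \<open>n\<close> pays for restarting the tree; the \<open>Suc\<close> pays for the final
  search.\<close>

lemma solvable_tree_state:
  assumes "n \<le> 2 ^ j"
  shows "solvable ((6 * j + 3) * Suc (n * (M - k) + (n - card W))) (tree_state M x k W p)"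
proof (induction "n * (M - k) + (n - card W)" arbitrary: x k W p rule: less_induct)
  case less
  define \<mu> where "\<mu> = n * (M - k) + (n - card W)"
  show ?case
  proof (rule solvable_assume)
    fix E0 assume E0: "tree_state M x k W p E0"
    then have W: "separates W" by (simp add: tree_state_def)
    then have WV: "W \<subseteq> {0..<n}" and sW: "s \<in> W" and tW: "t \<notin> W" by (auto simp: separates_def)
    have finW: "finite W" using WV finite_subset by blast
    have "W \<subset> {0..<n}" using WV tW t_less by auto
    then have cardW: "card W < n" using psubset_card_mono[of "{0..<n}" W] by simp
    have "solvable ((6 * j + 3) * \<mu> + (6 * j + 3)) (tree_state M x k W p)"
    proof (rule solvable_find[of W "{0..<n} - W" _ _ x])
      fix u v assume u: "u \<in> W" and v: "v \<in> {0..<n} - W"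
      show "solvable ((6 * j + 3) * \<mu>) (\<lambda>E. tree_state M x k W p E \<and> residual x E u v)"
      proof (cases "v = t")
        case False
        let ?W = "insert v W" and ?p = "p(v := v # p u)"
        have "tree_state M x k ?W ?p E" if "tree_state M x k W p E" "residual x E u v" for E
        proof -
          have pu: "p u \<noteq> []" "distinct (p u)" "set (p u) \<subseteq> W" "hd (p u) = u" "last (p u) = s"
            "successively (\<lambda>v u. residual x E u v) (p u)"
            using that u by (auto simp: tree_state_def)
          then have "successively (\<lambda>v u. residual x E u v) (v # p u)"
            using that(2) by (simp add: successively_Cons)
          moreover have "distinct (v # p u)" "set (v # p u) \<subseteq> ?W" "separates ?W"
            using pu v W False by (auto simp: separates_def)
          ultimately show ?thesis
            using that(1) pu(1,5) unfolding tree_state_def by auto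
        qed
        moreover have \<mu>': "n * (M - k) + (n - card ?W) < \<mu>"
          using finW v cardW by (simp add: \<mu>_def)
        then have "(6 * j + 3) * Suc (n * (M - k) + (n - card ?W)) \<le> (6 * j + 3) * \<mu>"
          by (intro mult_le_mono2) simp
        ultimately show ?thesis
          using less[OF \<mu>'[unfolded \<mu>_def], of x ?p] by (blast intro: solvable_mono)
      next
        case True
        let ?x = "\<lambda>a b. x a b + path_flow (t # p u) a b"
        have flow: "is_flow ?x (Suc k) E" if "tree_state M x k W p E" "residual x E u v" for E
        proof -
          have pu: "p u \<noteq> []" "distinct (p u)" "set (p u) \<subseteq> W" "hd (p u) = u" "last (p u) = s"
            "successively (\<lambda>v u. residual x E u v) (p u)" "is_flow x k E"
            using that u by (auto simp: tree_state_def)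
          then have "successively (\<lambda>v u. residual x E u v) (t # p u)"
            using that(2) True by (simp add: successively_Cons)
          then show ?thesis using pu tW by (intro is_flow_augment) auto
        qed
        show ?thesis
        proof (rule solvable_assume)
          fix E1 assume E1: "tree_state M x k W p E1 \<and> residual x E1 u v"
          then obtain S where "separates S" "cut_value n E1 S \<le> M" by (auto simp: tree_state_def)
          \<comment> \<open>The augmented flow still fits below the cut, so the truncated difference
            \<open>M - k\<close> really drops.\<close>
          then have "Suc k \<le> M" using flow[of E1] E1 flow_le_cut_value by fastforce
          then have "M - k = Suc (M - Suc k)" by simp
          then have \<mu>': "n * (M - Suc k) + (n - card {s}) < \<mu>"
            using s_less cardW by (simp add: \<mu>_def)
          then have "(6 * j + 3) * Suc (n * (M - Suc k) + (n - card {s})) \<le> (6 * j + 3) * \<mu>"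
            by (intro mult_le_mono2) simp
          moreover have "tree_state M ?x (Suc k) {s} (\<lambda>_. [s]) E"
            if "tree_state M x k W p E" "residual x E u v" for E
            using flow[OF that] that(1) tree_state_init by (auto simp: tree_state_def[of M x])
          ultimately show "solvable ((6 * j + 3) * \<mu>) (\<lambda>E. tree_state M x k W p E \<and> residual x E u v)"
            using less[OF \<mu>'[unfolded \<mu>_def], of ?x "\<lambda>_. [s]"] by (blast intro: solvable_mono)
        qed
      qed
    next
      have "min_st_cut n E s t W"
        if "tree_state M x k W p E" "\<not> (\<exists>u\<in>W. \<exists>v\<in>{0..<n} - W. residual x E u v)" for E
        using that residual_closed_is_min_cut[of x k E W] by (simp add: tree_state_def)
      then show "solvable ((6 * j + 3) * \<mu>)
          (\<lambda>E. tree_state M x k W p E \<and> \<not> (\<exists>u\<in>W. \<exists>v\<in>{0..<n} - W. residual x E u v))"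
        unfolding solvable_def by (intro exI[of _ "Ret W"]) auto
    qed (use WV assms in \<open>auto simp: tree_state_def is_flow_def\<close>)
    then show "solvable ((6 * j + 3) * Suc (n * (M - k) + (n - card W))) (tree_state M x k W p)"
      by (simp add: \<mu>_def algebra_simps)
  qed
qed

section \<open>First phase: distance labels and depth-first search\<close>

text \<open>Validity on residual arcs makes \<open>d\<close> a lower bound for the residual distance
  to \<open>t\<close>. The list \<open>ps\<close> is the current search path, whose labels fall by
  one per arc on the way from \<open>s\<close> to the head.\<close>

definition label_state ::
  "nat \<Rightarrow> (nat \<Rightarrow> nat \<Rightarrow> int) \<Rightarrow> nat \<Rightarrow> (nat \<Rightarrow> nat) \<Rightarrow> nat list \<Rightarrow> (nat \<Rightarrow> nat \<Rightarrow> bool) \<Rightarrow> bool" where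
  "label_state D x k d ps E \<longleftrightarrow> is_flow x k E \<and> d t = 0 \<and> (\<forall>v. d v \<le> D) \<and>
     (\<forall>u v. residual x E u v \<longrightarrow> d u \<le> Suc (d v)) \<and> ps \<noteq> [] \<and> last ps = s \<and>
     successively (\<lambda>v u. residual x E u v \<and> d u = Suc (d v)) ps"

text \<open>Averaging: each level belongs to at most two of the \<open>D\<close> pairs, so the pairs
  have total size at most \<open>2 * n\<close>.\<close>

lemma ex_small_consecutive_levels:
  fixes d :: "nat \<Rightarrow> nat"
  assumes "0 < D"
  obtains i where "i < D"
    "D * (card {v\<in>{0..<n}. d v = Suc i} + card {v\<in>{0..<n}. d v = i}) \<le> 2 * n"
proof -
  define l where "l i = card {v\<in>{0..<n}. d v = i}" for i
  have total: "(\<Sum>i\<in>I. l i) \<le> n" if "finite I" for I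
  proof -
    have "(\<Sum>i\<in>I. l i) = card (\<Union>i\<in>I. {v\<in>{0..<n}. d v = i})"
      using that unfolding l_def by (intro card_UN_disjoint[symmetric]) auto
    also have "\<dots> \<le> card {0..<n}" by (intro card_mono) auto
    finally show ?thesis by simp
  qed
  have "(\<Sum>i<D. l (Suc i) + l i) \<le> 2 * n"
    using total[of "Suc ` {..<D}"] total[of "{..<D}"] by (simp add: sum.distrib sum.reindex)
  moreover have "\<exists>i<D. D * (l (Suc i) + l i) \<le> 2 * n" if le: "(\<Sum>i<D. l (Suc i) + l i) \<le> 2 * n"
  proof (rule ccontr)
    assume "\<not> (\<exists>i<D. D * (l (Suc i) + l i) \<le> 2 * n)"
    then have "(\<Sum>i<D. 2 * n) < (\<Sum>i<D. D * (l (Suc i) + l i))"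
      using assms by (intro sum_strict_mono) (auto simp: not_le)
    then have "D * (2 * n) < D * (\<Sum>i<D. l (Suc i) + l i)" by (simp add: sum_distrib_left)
    then show False using le by simp
  qed
  ultimately show ?thesis using that by (auto simp: l_def)
qed

text \<open>Cut above a sparse pair of levels. A residual arc lowers the label by at most one, so
  every residual arc out of \<open>S\<close> runs from \<open>A\<close> to \<open>B\<close>, with
  capacity at most 2.\<close>

lemma label_state_small_cut:
  assumes st: "label_state D x k d ps E" and "d s = D" "0 < D" "n ^ 2 \<le> D ^ 3"
  obtains S where "separates S" "cut_value n E S \<le> k + 2 * D"
proof -
  obtain i where i: "i < D"
    "D * (card {v\<in>{0..<n}. d v = Suc i} + card {v\<in>{0..<n}. d v = i}) \<le> 2 * n"
    using ex_small_consecutive_levels[OF assms(3)] .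
  define A where "A = {v\<in>{0..<n}. d v = Suc i}"
  define B where "B = {v\<in>{0..<n}. d v = i}"
  define S where "S = {v\<in>{0..<n}. i < d v}"
  have flow: "is_flow x k E" and dt: "d t = 0"
    and lab: "\<And>u v. residual x E u v \<Longrightarrow> d u \<le> Suc (d v)"
    using st by (auto simp: label_state_def)
  have feas: "feasible x E" using flow by (simp add: is_flow_def)
  have S: "separates S" using i(1) assms(2) dt s_less by (auto simp: separates_def S_def)
  have "(\<Sum>u\<in>S. \<Sum>v\<in>{0..<n} - S. of_bool (E u v) - x u v)
      = (\<Sum>u\<in>A. \<Sum>v\<in>{0..<n} - S. of_bool (E u v) - x u v)"
  proof (rule sum.mono_neutral_right)
    show "\<forall>u\<in>S - A. (\<Sum>v\<in>{0..<n} - S. of_bool (E u v) - x u v) = 0"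
    proof (intro ballI sum.neutral)
      fix u v assume "u \<in> S - A" "v \<in> {0..<n} - S"
      then have "\<not> d u \<le> Suc (d v)" by (auto simp: S_def A_def)
      then show "of_bool (E u v) - x u v = 0" using lab residual_capacity(3)[OF feas] by blast
    qed
  qed (auto simp: S_def A_def)
  also have "\<dots> = (\<Sum>u\<in>A. \<Sum>v\<in>B. of_bool (E u v) - x u v)"
  proof (rule sum.cong[OF refl], rule sum.mono_neutral_right)
    fix u assume u: "u \<in> A"
    show "\<forall>v\<in>{0..<n} - S - B. of_bool (E u v) - x u v = 0"
    proof
      fix v assume "v \<in> {0..<n} - S - B"
      with u have "\<not> d u \<le> Suc (d v)" by (auto simp: S_def A_def B_def)
      then show "of_bool (E u v) - x u v = 0" using lab residual_capacity(3)[OF feas] by blast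
    qed
  qed (auto simp: S_def B_def)
  also have "\<dots> \<le> (\<Sum>u\<in>A. \<Sum>v\<in>B. 2)" by (intro sum_mono residual_capacity(2) feas)
  also have "\<dots> = int (2 * (card A * card B))" by simp
  finally have cut: "cut_value n E S \<le> k + 2 * (card A * card B)"
    using cut_value_eq_flow_plus_residual[OF flow S] by linarith
  \<comment> \<open>The arithmetic-geometric mean inequality; with \<open>n ^ 2 \<le> D ^ 3\<close>
    it gives \<open>card A * card B \<le> D\<close>.\<close>
  have "4 * (card A * card B) \<le> (card A + card B)\<^sup>2"
    using zero_le_power2[of "int (card A) - int (card B)"]
    by (simp add: power2_eq_square algebra_simps flip: of_nat_le_iff[where 'a = int])
  then have "D\<^sup>2 * (4 * (card A * card B)) \<le> (D * (card A + card B))\<^sup>2"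
    by (simp add: power_mult_distrib)
  also have "\<dots> \<le> (2 * n)\<^sup>2" using i(2) by (intro power_mono) (auto simp: A_def B_def)
  also have "\<dots> \<le> 4 * D ^ 3" using assms(4) by (simp add: power_mult_distrib)
  also have "\<dots> = D\<^sup>2 * (4 * D)" by (simp add: power2_eq_square power3_eq_cube)
  finally have "card A * card B \<le> D" using assms(3) by simp
  then show ?thesis using cut S by (intro that[of S]) auto
qed

text \<open>
  The potential of a search state: a relabelling pays for the step itself and for the loss of one
  path vertex, an augmentation pays for the loss of the whole path.
\<close>

definition potential :: "nat \<Rightarrow> nat \<Rightarrow> (nat \<Rightarrow> nat) \<Rightarrow> nat list \<Rightarrow> nat" where
  "potential D k d ps = 2 * (n * D - (\<Sum>v<n. d v)) + (D + 2) * (n - k) + (D + 2 - length ps)"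

text \<open>New residual arcs reverse path arcs and so raise the label by one; the labels stay valid
  and the search restarts at \<open>s\<close>.\<close>

lemma label_state_augment:
  assumes st: "label_state D x k d ps E" and t: "hd ps = t"
  shows "label_state D (\<lambda>a b. x a b + path_flow ps a b) (Suc k) d [s] E"
proof -
  have suc: "successively (\<lambda>v u. residual x E u v \<and> d u = Suc (d v)) ps" and ne: "ps \<noteq> []"
    using st by (auto simp: label_state_def)
  have dist: "distinct ps"
    by (rule label_path(1)[of d]) (use suc ne in \<open>auto elim: successively_mono\<close>)
  have "is_flow (\<lambda>a b. x a b + path_flow ps a b) (Suc k) E"
    using st t dist by (intro is_flow_augment) (auto simp: label_state_def elim: successively_mono)
  moreover have "d u \<le> Suc (d v)" if "residual (\<lambda>a b. x a b + path_flow ps a b) E u v" for u v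
    using path_flow_cases[OF dist suc, of u v] that st
    by (auto simp: label_state_def residual_def)
  ultimately show ?thesis using st by (auto simp: label_state_def)
qed

lemma label_state_advance:
  assumes "label_state D x k d ps E" "residual x E (hd ps) v" "d (hd ps) = Suc (d v)"
  shows "label_state D x k d (v # ps) E"
  using assms by (auto simp: label_state_def successively_Cons)

text \<open>Without an admissible arc out of the head, its label can grow by one. The path arc into
  it then stops being admissible, so the search retreats, except from \<open>s\<close>
  itself.\<close>

lemma label_state_relabel:
  assumes st: "label_state D x k d ps E" and "d s < D" "hd ps \<noteq> t"
    and none: "\<not> (\<exists>v\<in>{v\<in>{0..<n}. d (hd ps) = Suc (d v)}. residual x E (hd ps) v)"
  shows "label_state D x k (d(hd ps := Suc (d (hd ps)))) (if tl ps = [] then ps else tl ps) E"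
proof -
  define u where "u = hd ps"
  let ?d = "d(u := Suc (d u))"
  have suc: "successively (\<lambda>v u. residual x E u v \<and> d u = Suc (d v)) ps" and ne: "ps \<noteq> []"
    and last: "last ps = s" and graph: "simple_graph n E"
    using st by (auto simp: label_state_def is_flow_def)
  have lp: "distinct ps" "Suc (d (last ps)) = d (hd ps) + length ps"
    by (rule label_path[of d]; use suc ne in \<open>auto elim: successively_mono\<close>)+
  have ps: "ps = u # tl ps" using ne by (simp add: u_def)
  \<comment> \<open>The head has label at most \<open>d s\<close>, hence below \<open>D\<close>, so
    raising it respects the cap.\<close>
  have "length ps \<ge> 1" using ne by (cases ps) auto
  then have "d u < D" using lp(2) last assms(2) by (simp add: u_def)
  moreover have "?d a \<le> Suc (?d b)" if ab: "residual x E a b" for a b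
  proof -
    have le: "d a \<le> Suc (d b)" using st ab by (simp add: label_state_def)
    have "a \<noteq> b" "b < n" using ab graph by (auto simp: residual_def simple_graph_def)
    then have "d a \<noteq> Suc (d b)" if "a = u" using none ab that by (auto simp: u_def)
    then show ?thesis using le \<open>a \<noteq> b\<close> by auto
  qed
  moreover have "successively (\<lambda>v w. residual x E w v \<and> ?d w = Suc (?d v)) (tl ps)"
  proof -
    have "successively (\<lambda>v u. residual x E u v \<and> d u = Suc (d v)) (tl ps)"
      using suc by (subst (asm) ps) (auto simp: successively_Cons)
    moreover have "u \<notin> set (tl ps)" using lp(1) by (subst (asm) ps) simp
    ultimately show ?thesis by (auto elim!: successively_mono)
  qed
  moreover have "last (tl ps) = s" if "tl ps \<noteq> []" using last that by (simp add: last_tl)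
  moreover have "successively (\<lambda>v w. residual x E w v \<and> ?d w = Suc (?d v)) ps" if "tl ps = []"
    using that by (subst ps) simp
  ultimately show ?thesis
    using st assms(3) unfolding label_state_def u_def[symmetric] by simp
qed

text \<open>Every unit of potential pays for one arc search; augmenting itself needs no query. The
  extra \<open>n * (2 * D) + n\<close> is reserved for the second phase.\<close>

lemma solvable_label_state:
  assumes j: "n \<le> 2 ^ j" and D: "0 < D" "n ^ 2 \<le> D ^ 3"
  shows "solvable ((6 * j + 3) * (potential D k d ps + n * (2 * D) + n)) (label_state D x k d ps)"
proof (induction "potential D k d ps" arbitrary: x k d ps rule: less_induct)
  case less
  let ?L = "6 * j + 3"
  show ?case
  proof (rule solvable_assume)
    fix E0 assume E0: "label_state D x k d ps E0"
    then have ne: "ps \<noteq> []" and last: "last ps = s" and dD: "\<And>v. d v \<le> D" and flow0: "is_flow x k E0"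
      and suc0: "successively (\<lambda>v u. residual x E0 u v \<and> d u = Suc (d v)) ps"
      by (auto simp: label_state_def)
    have lp: "Suc (d (last ps)) = d (hd ps) + length ps"
      by (rule label_path(3)) (use suc0 ne in \<open>auto elim: successively_mono\<close>)
    then have len: "length ps \<le> Suc D" using dD[of "last ps"] by linarith
    have hdn: "hd ps < n"
    proof (cases "tl ps")
      case Nil
      then show ?thesis using ne last s_less by (cases ps) auto
    next
      case (Cons u us)
      then have "residual x E0 u (hd ps)" using ne suc0 by (cases ps) auto
      then show ?thesis using flow0 by (auto simp: is_flow_def simple_graph_def residual_def)
    qed
    show "solvable (?L * (potential D k d ps + n * (2 * D) + n)) (label_state D x k d ps)"
    proof (cases "d s = D")
      case True
      \<comment> \<open>The sparse levels supply the bound \<open>M = k + 2 * D\<close> for the tree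
        phase.\<close>
      have "tree_state (k + 2 * D) x k {s} (\<lambda>_. [s]) E" if E: "label_state D x k d ps E" for E
      proof -
        obtain S where "separates S" "cut_value n E S \<le> k + 2 * D"
          using label_state_small_cut[OF E True D] .
        then show ?thesis using E tree_state_init by (auto simp: label_state_def)
      qed
      moreover have "?L * Suc (n * (k + 2 * D - k) + (n - card {s})) \<le>
          ?L * (potential D k d ps + n * (2 * D) + n)"
        using s_less by (intro mult_le_mono2) simp
      ultimately show ?thesis
        using solvable_tree_state[OF j, of "k + 2 * D" k "{s}" x "\<lambda>_. [s]"] by (blast intro: solvable_mono)
    next
      case False
      then have dsD: "d s < D" using dD[of s] by simp
      show ?thesis
      proof (cases "hd ps = t")
        case True
        let ?x = "\<lambda>a b. x a b + path_flow ps a b"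
        \<comment> \<open>The fixed graph carries the augmented flow, so \<open>n - k\<close> drops
          by exactly one.\<close>
        have "Suc k \<le> n" using flow_le label_state_augment[OF E0 True] by (auto simp: label_state_def)
        then have "n - k = Suc (n - Suc k)" by simp
        then have pot: "potential D (Suc k) d [s] < potential D k d ps"
          using len by (simp add: potential_def)
        then have "?L * (potential D (Suc k) d [s] + n * (2 * D) + n) \<le>
            ?L * (potential D k d ps + n * (2 * D) + n)"
          by (intro mult_le_mono2) simp
        then show ?thesis
          using less[OF pot, of ?x] label_state_augment[OF _ True] by (blast intro: solvable_mono)
      next
        case False
        let ?u = "hd ps" and ?B = "{v\<in>{0..<n}. d (hd ps) = Suc (d v)}"
        let ?d = "d(hd ps := Suc (d (hd ps)))" and ?ps = "if tl ps = [] then ps else tl ps"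
        \<comment> \<open>One unit is spent on the search from the head; the potential is positive
          because a path has at most \<open>D + 1\<close> vertices.\<close>
        let ?q = "?L * (potential D k d ps - 1 + n * (2 * D) + n)"
        have potpos: "0 < potential D k d ps" using len by (simp add: potential_def)
        have step: "solvable ?q \<Psi>"
          if "potential D k d' ps' < potential D k d ps"
            "\<And>E. \<Psi> E \<Longrightarrow> label_state D x k d' ps' E" for \<Psi> d' ps'
        proof -
          have "?L * (potential D k d' ps' + n * (2 * D) + n) \<le> ?q"
            using that(1) by (intro mult_le_mono2) simp
          then show ?thesis using less[OF that(1), of x] that(2) by (blast intro: solvable_mono)
        qed
        have "solvable (?q + ?L) (label_state D x k d ps)"
        proof (rule solvable_find[of "{?u}" ?B _ _ x])
          fix u v assume uv: "u \<in> {?u}" "v \<in> ?B"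
          have "potential D k d (v # ps) < potential D k d ps"
            using len by (simp add: potential_def)
          then show "solvable ?q (\<lambda>E. label_state D x k d ps E \<and> residual x E u v)"
            by (rule step) (use uv label_state_advance in auto)
        next
          \<comment> \<open>The raised labels still respect the cap, so truncation is harmless: the
            label term falls by 2, and retreating gives back at most 1.\<close>
          have pot: "potential D k ?d ?ps < potential D k d ps"
            if st: "label_state D x k ?d ?ps E" for E
          proof -
            have "(\<Sum>v<n. ?d v) \<le> (\<Sum>v<n. D)"
              using st by (intro sum_mono) (simp add: label_state_def)
            then have "(\<Sum>v<n. ?d v) \<le> n * D" by simp
            moreover have "(\<Sum>v<n. ?d v) = Suc (\<Sum>v<n. d v)"
            proof -
              have "(\<Sum>v<n. ?d v) = (\<Sum>v<n. d v + of_bool (v = ?u))"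
                by (intro sum.cong) auto
              then show ?thesis using hdn by (simp add: sum.distrib of_bool_def)
            qed
            ultimately have "n * D - (\<Sum>v<n. d v) = Suc (n * D - (\<Sum>v<n. ?d v))" by simp
            moreover have "D + 2 - length ?ps \<le> Suc (D + 2 - length ps)" using ne by simp arith
            ultimately show ?thesis unfolding potential_def by simp
          qed
          let ?\<Psi> = "\<lambda>E. label_state D x k d ps E \<and> \<not> (\<exists>u\<in>{?u}. \<exists>v\<in>?B. residual x E u v)"
          have relabel: "label_state D x k ?d ?ps E" if "?\<Psi> E" for E
            by (rule label_state_relabel) (use that dsD False in auto)
          show "solvable ?q ?\<Psi>"
          proof (rule solvable_assume)
            fix E assume "?\<Psi> E"
            then show "solvable ?q ?\<Psi>" by (rule step[OF pot[OF relabel] relabel])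
          qed
        qed (use hdn j in \<open>auto simp: label_state_def is_flow_def\<close>)
        moreover have "?q + ?L = ?L * (potential D k d ps + n * (2 * D) + n)"
          using potpos by (cases "potential D k d ps") (simp_all add: algebra_simps)
        ultimately show ?thesis by simp
      qed
    qed
  qed
qed

section \<open>Choosing the parameters\<close>

theorem solvable_within:
  assumes "n \<le> 2 ^ j" "0 < D" "n ^ 2 \<le> D ^ 3"
  shows "solvable ((6 * j + 3) * (11 * n * D)) (\<lambda>_. True)"
proof -
  \<comment> \<open>The sum is \<open>5 * n * D + 3 * n + D + 1\<close>, and each of
    \<open>n\<close>, \<open>D\<close>, \<open>1\<close> is at most \<open>n * D\<close>.\<close>
  have "potential D 0 (\<lambda>_. 0) [s] + n * (2 * D) + n \<le> 11 * n * D"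
  proof -
    have "n \<le> n * D" "D \<le> n * D" "1 \<le> n * D" using assms(2) s_less by simp_all
    moreover have "potential D 0 (\<lambda>_. 0) [s] = 3 * (n * D) + 2 * n + D + 1"
      by (simp add: potential_def algebra_simps)
    ultimately show ?thesis by linarith
  qed
  then have "(6 * j + 3) * (potential D 0 (\<lambda>_. 0) [s] + n * (2 * D) + n) \<le> (6 * j + 3) * (11 * n * D)"
    by (rule mult_le_mono2)
  moreover have "label_state D (\<lambda>_ _. 0) 0 (\<lambda>_. 0) [s] E" if "simple_graph n E" for E
    using that by (auto simp: label_state_def is_flow_def feasible_def)
  ultimately show ?thesis
    using solvable_label_state[OF assms, of 0 "\<lambda>_. 0" "[s]" "\<lambda>_ _. 0"] by (blast intro: solvable_mono)
qed

end

lemma query_bound: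
  fixes n :: nat
  assumes "2 \<le> n"
  obtains j D where "n \<le> 2 ^ j" "0 < D" "n ^ 2 \<le> D ^ 3"
    "real ((6 * j + 3) * (11 * n * D)) \<le> 660 * real n powr (5/3) * ln (real n)"
proof -
  define D where "D = nat \<lceil>real n powr (2/3)\<rceil>"
  define j where "j = nat \<lceil>log 2 (real n)\<rceil>"
  have n0: "0 < real n" "1 \<le> real n" using assms by auto
  have ge1: "1 \<le> real n powr (2/3)" using n0 by (simp add: ge_one_powr_ge_zero)
  have D1: "real n powr (2/3) \<le> real D" unfolding D_def by linarith
  have D2: "real D \<le> 2 * real n powr (2/3)" using ge1 unfolding D_def by linarith
  have D0: "0 < D" using D1 ge1 by (cases D) auto
  have "real n ^ 2 = (real n powr (2/3)) ^ 3"
    using n0 by (simp add: powr_powr flip: powr_realpow powr_numeral)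
  also have "\<dots> \<le> real D ^ 3" using D1 by (intro power_mono) auto
  finally have D3: "n ^ 2 \<le> D ^ 3" by (simp flip: of_nat_power)
  have log0: "0 \<le> log 2 (real n)" using n0 by simp
  have "real n = 2 powr log 2 (real n)" using n0 by simp
  also have "\<dots> \<le> 2 powr real j" unfolding j_def by (intro powr_mono) linarith+
  also have "\<dots> = real (2 ^ j)" by (simp add: powr_realpow)
  finally have j1: "n \<le> 2 ^ j" by (simp only: of_nat_le_iff)
  have ln2: "2/3 \<le> ln (2::real)" by (rule ln2_ge_two_thirds)
  have lnn: "ln 2 \<le> ln (real n)" using assms by simp
  have "real j \<le> log 2 (real n) + 1" using log0 unfolding j_def by linarith
  also have "log 2 (real n) = ln (real n) / ln 2" by (simp add: log_def)
  also have "\<dots> \<le> ln (real n) / (2/3)" using ln2 lnn by (intro divide_left_mono) auto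
  \<comment> \<open>Here \<open>6 * j + 3\<close> is at most \<open>9 * ln n + 9\<close>, and
    \<open>ln n \<ge> 2/3\<close> absorbs the constant.\<close>
  finally have "real (6 * j + 3) \<le> 30 * ln (real n)" using ln2 lnn by simp
  moreover have "real (11 * n * D) \<le> 22 * (real n * real n powr (2/3))"
    using D2 n0 by (simp add: mult_left_mono)
  ultimately have "real (6 * j + 3) * real (11 * n * D)
      \<le> (30 * ln (real n)) * (22 * (real n * real n powr (2/3)))"
    using ln2 lnn by (intro mult_mono) auto
  moreover have "real n * real n powr (2/3) = real n powr (5/3)"
    using n0 by (simp add: powr_mult_base)
  ultimately have "real ((6 * j + 3) * (11 * n * D)) \<le> 660 * real n powr (5/3) * ln (real n)"
    by (simp only: of_nat_mult) (simp add: algebra_simps)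
  then show ?thesis using that j1 D0 D3 by blast
qed

theorem mainTheorem2:
  shows "\<exists>(A :: rand_alg) (C :: real) (k :: nat) (c :: real). c > 0 \<and>
    (\<forall>n s t E. 2 \<le> n \<and> s < n \<and> t < n \<and> s \<noteq> t \<and> simple_graph n E \<longrightarrow>
       (\<forall>T \<in> set_pmf (A n s t).
          real (run_queries n E T) \<le> C * real n powr (5/3) * (ln (real n)) ^ k) \<and>
       measure_pmf.prob (A n s t) {T. min_st_cut n E s t (run_output n E T)}
         \<ge> 1 - real n powr (- c))"
proof -
  have "\<exists>T. \<forall>E. 2 \<le> n \<and> s < n \<and> t < n \<and> s \<noteq> t \<and> simple_graph n E \<longrightarrow>
      real (run_queries n E T) \<le> 660 * real n powr (5/3) * ln (real n) \<and>
      min_st_cut n E s t (run_output n E T)" for n s t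
  proof (cases "2 \<le> n \<and> s < n \<and> t < n \<and> s \<noteq> t")
    case True
    then interpret st_cut n s t by unfold_locales auto
    obtain j D where jD: "n \<le> 2 ^ j" "0 < D" "n ^ 2 \<le> D ^ 3"
      and bound: "real ((6 * j + 3) * (11 * n * D)) \<le> 660 * real n powr (5/3) * ln (real n)"
      using query_bound True by blast
    obtain T where T: "\<And>E. simple_graph n E \<Longrightarrow> run_queries n E T \<le> (6 * j + 3) * (11 * n * D) \<and>
        min_st_cut n E s t (run_output n E T)"
      using solvable_within[OF jD] unfolding solvable_def by blast
    show ?thesis
    proof (intro exI[of _ T] allI impI conjI)
      fix E assume "2 \<le> n \<and> s < n \<and> t < n \<and> s \<noteq> t \<and> simple_graph n E"
      then have *: "run_queries n E T \<le> (6 * j + 3) * (11 * n * D)"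
        "min_st_cut n E s t (run_output n E T)" using T by auto
      show "real (run_queries n E T) \<le> 660 * real n powr (5/3) * ln (real n)"
        using bound of_nat_mono[OF *(1), where 'a = real] by (rule order_trans[rotated])
      show "min_st_cut n E s t (run_output n E T)" by fact
    qed
  qed auto
  then obtain T where T: "\<And>n s t E. 2 \<le> n \<and> s < n \<and> t < n \<and> s \<noteq> t \<and> simple_graph n E \<Longrightarrow>
      real (run_queries n E (T n s t)) \<le> 660 * real n powr (5/3) * ln (real n) \<and>
      min_st_cut n E s t (run_output n E (T n s t))"
    by metis
  show ?thesis
  \<comment> \<open>A point mass on the deterministic tree succeeds with probability 1, so the
    exponent \<open>c = 1\<close> is an arbitrary positive choice.\<close>
  proof (rule exI[of _ "\<lambda>n s t. return_pmf (T n s t)"], rule exI[of _ 660], rule exI[of _ 1],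
      rule exI[of _ 1], intro conjI allI impI ballI)
    fix n s t E assume *: "2 \<le> n \<and> s < n \<and> t < n \<and> s \<noteq> t \<and> simple_graph n E"
    show "real (run_queries n E U) \<le> 660 * real n powr (5/3) * ln (real n) ^ 1"
      if "U \<in> set_pmf (return_pmf (T n s t))" for U
      using T[OF *] that by simp
    show "1 - real n powr - 1 \<le> measure_pmf.prob (return_pmf (T n s t))
        {T. min_st_cut n E s t (run_output n E T)}"
      using T[OF *] by (simp add: indicator_def)
  qed simp
qed

end
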